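(* Let $n,M\ge 1$, $\mathbf{Y}\in\mathbb{R}^n$, $\mathbf{f}_1,\dots,\mathbf{f}_M\in\mathbb{R}^n$, $\boldsymbol{\pi}\in\Lambda^M$, $\nu\in(0,1)$ and $\omega>0$. Let $$\boldsymbol{\psi}_X(\omega^2,\nu)=\operatorname*{argmin}_{\boldsymbol{\psi}\in\mathbb{R}^n} J(\boldsymbol{\psi}),\qquad J(\boldsymbol{\psi})=\sum_{j=1}^M \pi_j \exp\left(-\frac{1}{2\omega^2}\|\mathbf{f}_j-\mathbf{Y}\|_2^2+\frac{1-\nu}{2\omega^2}\|\boldsymbol{\psi}-\mathbf{f}_j\|_2^2\right),$$ and let $\boldsymbol{\lambda}^Q\in\operatorname*{argmin}_{\boldsymbol{\lambda}\in\Lambda^M}Q(\boldsymbol{\lambda})$, where $$Q(\boldsymbol{\lambda})=\|\mathbf{f}_{\boldsymbol{\lambda}}-\mathbf{Y}\|_2^2+\nu\sum_{j=1}^M\lambda_j\|\mathbf{f}_j-\mathbf{f}_{\boldsymbol{\lambda}}\|_2^2+2\omega^2\,\mathcal{K}(\boldsymbol{\lambda},\boldsymbol{\pi}).$$ Then $\boldsymbol{\psi}_X(\omega^2,\nu)=\mathbf{f}_{\boldsymbol{\lambda}^Q}$.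
   Context: $\Lambda^M=\{\boldsymbol{\lambda}\in\mathbb{R}^M:\lambda_j\ge 0,\ \sum_{j=1}^M\lambda_j=1\}$. For $\boldsymbol{\lambda}\in\Lambda^M$, $\mathbf{f}_{\boldsymbol{\lambda}}=\sum_{j=1}^M\lambda_j\mathbf{f}_j$. The Kullback-Leibler divergence is $\mathcal{K}(\boldsymbol{\lambda},\boldsymbol{\pi})=\sum_{j=1}^M\lambda_j\log(\lambda_j/\pi_j)$, with the conventions that a term with $\lambda_j=0$ equals $0$ and a term with $\lambda_j>0$, $\pi_j=0$ equals $+\infty$. *)

theory Defs
  imports "HOL-Analysis.Analysis"
begin

definition prob_simplex :: "(real ^ 'm::finite) set" where
  "prob_simplex = {l. (\<forall>j. 0 \<le> l $ j) \<and> (\<Sum>j\<in>UNIV. l $ j) = 1}"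

definition mixture :: "('m::finite \<Rightarrow> real ^ 'n::finite) \<Rightarrow> real ^ 'm \<Rightarrow> real ^ 'n" where
  "mixture f l = (\<Sum>j\<in>UNIV. l $ j *\<^sub>R f j)"

(* Extended-real valued, unlike KL_divergence of HOL-Probability: it is infinite
   as soon as l is not absolutely continuous with respect to p. *)
definition KL :: "real ^ 'm::finite \<Rightarrow> real ^ 'm \<Rightarrow> ereal" where
  "KL l p = (\<Sum>j\<in>UNIV.
     if l $ j = 0 then 0
     else if p $ j = 0 then \<infinity>
     else ereal (l $ j * ln (l $ j / p $ j)))"

definition J :: "real \<Rightarrow> real \<Rightarrow> real ^ 'm::finite \<Rightarrow> ('m \<Rightarrow> real ^ 'n::finite) \<Rightarrow>
    real ^ 'n \<Rightarrow> real ^ 'n \<Rightarrow> real" where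
  "J \<omega> \<nu> p f Y \<psi> = (\<Sum>j\<in>UNIV. p $ j *
     exp (- (1 / (2 * \<omega>\<^sup>2)) * (norm (f j - Y))\<^sup>2
          + (1 - \<nu>) / (2 * \<omega>\<^sup>2) * (norm (\<psi> - f j))\<^sup>2))"

definition Q :: "real \<Rightarrow> real \<Rightarrow> real ^ 'm::finite \<Rightarrow> ('m \<Rightarrow> real ^ 'n::finite) \<Rightarrow>
    real ^ 'n \<Rightarrow> real ^ 'm \<Rightarrow> ereal" where
  "Q \<omega> \<nu> p f Y l =
     ereal ((norm (mixture f l - Y))\<^sup>2
            + \<nu> * (\<Sum>j\<in>UNIV. l $ j * (norm (f j - mixture f l))\<^sup>2))
     + ereal (2 * \<omega>\<^sup>2) * KL l p"

(* arg_min picks an arbitrary minimizer and is unspecified if there is none, so this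
   is the intended vector only together with existence and uniqueness of the minimizer. *)
definition psi_X :: "real \<Rightarrow> real \<Rightarrow> real ^ 'm::finite \<Rightarrow> ('m \<Rightarrow> real ^ 'n::finite) \<Rightarrow>
    real ^ 'n \<Rightarrow> real ^ 'n" where
  "psi_X \<omega> \<nu> p f Y = arg_min (J \<omega> \<nu> p f Y) (\<lambda>_. True)"

end

theory Submission imports Defs
begin

text \<open>
  By the bias--variance identity, for every \<open>\<psi>\<close> the functional \<open>Q\<close> equals
  \<open>(1 - \<nu>) \<parallel>\<psi> - f\<^sub>\<lambda>\<parallel>\<^sup>2 + 2 \<omega>\<^sup>2 (KL(\<lambda>, \<pi>) - \<Sum>\<^sub>j \<lambda>\<^sub>j g\<^sub>j(\<psi>))\<close>, where \<open>g\<^sub>j(\<psi>)\<close> are the exponents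
  in \<open>J\<close>. Gibbs' variational principle therefore gives
  \<open>Q(\<lambda>) \<ge> (1 - \<nu>) \<parallel>\<psi> - f\<^sub>\<lambda>\<parallel>\<^sup>2 - 2 \<omega>\<^sup>2 ln J(\<psi>)\<close> for all \<open>\<lambda>\<close> and \<open>\<psi>\<close>. If \<open>\<psi>\<close> minimizes \<open>J\<close>, its
  first-order condition says that \<open>\<psi>\<close> is the mixture with the Gibbs weights, and
  for these weights \<open>Q = - 2 \<omega>\<^sup>2 ln J(\<psi>)\<close>. Comparing the two forces \<open>f\<^sub>\<lambda> = \<psi>\<close> for every minimizer
  \<open>\<lambda>\<close> of \<open>Q\<close>; comparing two minimizers of \<open>J\<close> in the same way shows that they coincide.
\<close>

section \<open>Probability weights and mixtures\<close>

lemma prob_simplex_nonneg: "l \<in> prob_simplex \<Longrightarrow> 0 \<le> l $ j"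
  and prob_simplex_sum: "l \<in> prob_simplex \<Longrightarrow> (\<Sum>j\<in>UNIV. l $ j) = 1"
  by (auto simp: prob_simplex_def)

lemma prob_simplex_pos_ex:
  assumes "p \<in> prob_simplex"
  obtains k where "0 < p $ k"
proof -
  have "\<exists>k. p $ k \<noteq> 0"
    using prob_simplex_sum[OF assms] by (metis sum.neutral zero_neq_one)
  with prob_simplex_nonneg[OF assms] show thesis
    by (metis less_eq_real_def that)
qed

text \<open>The cross term vanishes after expanding around the mixture, because the weighted
  deviations from it sum to zero.\<close>

lemma bias_variance_mixture:
  assumes "l \<in> prob_simplex"
  shows "(\<Sum>j\<in>UNIV. l $ j * (norm (f j - z))\<^sup>2) =
    (\<Sum>j\<in>UNIV. l $ j * (norm (f j - mixture f l))\<^sup>2) + (norm (mixture f l - z))\<^sup>2"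
proof -
  let ?m = "mixture f l"
  have sq: "(norm (f j - z))\<^sup>2 =
      (norm (f j - ?m))\<^sup>2 + 2 * ((f j - ?m) \<bullet> (?m - z)) + (norm (?m - z))\<^sup>2" for j
    by (simp add: power2_norm_eq_inner inner_diff_left inner_diff_right inner_commute)
  have "(\<Sum>j\<in>UNIV. l $ j * (norm (f j - z))\<^sup>2) =
      (\<Sum>j\<in>UNIV. l $ j * (norm (f j - ?m))\<^sup>2)
      + 2 * ((\<Sum>j\<in>UNIV. l $ j *\<^sub>R (f j - ?m)) \<bullet> (?m - z))
      + (\<Sum>j\<in>UNIV. l $ j) * (norm (?m - z))\<^sup>2"
    unfolding sq
    by (simp only: sum.distrib inner_sum_left inner_scaleR_left sum_distrib_left
        sum_distrib_right distrib_left mult.left_commute[of 2])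
  moreover have "(\<Sum>j\<in>UNIV. l $ j *\<^sub>R (f j - ?m)) = 0"
    using prob_simplex_sum[OF assms]
    by (simp add: scaleR_diff_right sum_subtractf mixture_def flip: scaleR_sum_left)
  ultimately show ?thesis
    using prob_simplex_sum[OF assms] by simp
qed

section \<open>Kullback-Leibler divergence and Gibbs' variational principle\<close>

lemma KL_eq_real:
  assumes "\<And>j. p $ j = 0 \<Longrightarrow> l $ j = 0"
  shows "KL l p = ereal (\<Sum>j\<in>UNIV. l $ j * ln (l $ j / p $ j))"
proof -
  have "KL l p = (\<Sum>j\<in>UNIV. ereal (l $ j * ln (l $ j / p $ j)))"
    unfolding KL_def using assms by (intro sum.cong) auto
  then show ?thesis by simp
qed

lemma KL_eq_infinity:
  assumes "p $ j = 0" "l $ j \<noteq> 0"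
  shows "KL l p = \<infinity>"
  unfolding KL_def using assms by (auto simp: sum_Pinfty)

text \<open>Without absolute continuity the right side is infinite. Otherwise this is ln r <= r - 1
  for the ratio r of the Gibbs weight to \<open>l $ j\<close>, averaged over \<open>l\<close>: both
  weight vectors sum to 1, so the upper bounds add up to 0.\<close>

lemma gibbs_variational:
  fixes l p :: "real ^ 'm::finite" and g :: "'m \<Rightarrow> real"
  assumes "l \<in> prob_simplex" "p \<in> prob_simplex"
  shows "ereal ((\<Sum>j\<in>UNIV. l $ j * g j) - ln (\<Sum>j\<in>UNIV. p $ j * exp (g j))) \<le> KL l p"
proof (cases "\<forall>j. p $ j = 0 \<longrightarrow> l $ j = 0")
  case False
  then show ?thesis using KL_eq_infinity by fastforce
next
  case True
  define Z where "Z = (\<Sum>j\<in>UNIV. p $ j * exp (g j))"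
  obtain k where "0 < p $ k" using prob_simplex_pos_ex assms(2) .
  then have "0 < Z"
    unfolding Z_def using prob_simplex_nonneg[OF assms(2)] by (intro sum_pos2[of _ k]) auto
  have "l $ j * (g j - ln Z) - l $ j * ln (l $ j / p $ j) \<le> p $ j * exp (g j) / Z - l $ j" for j
  proof (cases "l $ j = 0")
    \<comment> \<open>The ratio r is undefined here, but the left side is 0 and the right side is a
      nonnegative Gibbs weight.\<close>
    case True
    then show ?thesis using prob_simplex_nonneg[OF assms(2)] \<open>0 < Z\<close> by simp
  next
    case False
    with True prob_simplex_nonneg[OF assms(1), of j] prob_simplex_nonneg[OF assms(2), of j]
    have pos: "0 < l $ j" "0 < p $ j" by (auto simp: less_eq_real_def)
    define r where "r = p $ j * exp (g j) / Z / l $ j"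
    have "0 < r" using pos \<open>0 < Z\<close> by (simp add: r_def)
    have "ln r = g j - ln Z - ln (l $ j / p $ j)"
      using pos \<open>0 < Z\<close> by (simp add: r_def ln_div ln_mult)
    moreover have "ln r \<le> r - 1" using \<open>0 < r\<close> by (rule ln_le_minus_one)
    ultimately have "l $ j * (g j - ln Z - ln (l $ j / p $ j)) \<le> l $ j * (r - 1)"
      using pos by simp
    also have "\<dots> = p $ j * exp (g j) / Z - l $ j"
      using pos by (simp add: r_def right_diff_distrib)
    finally show ?thesis by (simp add: algebra_simps)
  qed
  then have "(\<Sum>j\<in>UNIV. l $ j * (g j - ln Z) - l $ j * ln (l $ j / p $ j))
      \<le> (\<Sum>j\<in>UNIV. p $ j * exp (g j) / Z - l $ j)"
    by (intro sum_mono) auto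
  also have "\<dots> = 0"
    using \<open>0 < Z\<close> prob_simplex_sum[OF assms(1)]
    by (simp add: sum_subtractf Z_def flip: sum_divide_distrib)
  finally have "(\<Sum>j\<in>UNIV. l $ j * g j) - ln Z \<le> (\<Sum>j\<in>UNIV. l $ j * ln (l $ j / p $ j))"
    using prob_simplex_sum[OF assms(1)]
    by (simp add: sum_subtractf right_diff_distrib flip: sum_distrib_right)
  then show ?thesis
    using True by (simp add: KL_eq_real Z_def)
qed

text \<open>The equality case of \<open>gibbs_variational\<close>: since the weights sum to 1,
  \<open>Z\<close> must be the normalizing sum.\<close>

lemma KL_gibbs_weights:
  fixes l p :: "real ^ 'm::finite" and g :: "'m \<Rightarrow> real"
  assumes "l \<in> prob_simplex" "0 < Z"
    and l: "\<And>j. l $ j = p $ j * exp (g j) / Z"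
  shows "KL l p = ereal ((\<Sum>j\<in>UNIV. l $ j * g j) - ln Z)"
proof -
  have "l $ j * ln (l $ j / p $ j) = l $ j * g j - l $ j * ln Z" for j
  proof (cases "p $ j = 0")
    case False
    then have "l $ j / p $ j = exp (g j) / Z" by (simp add: l)
    then show ?thesis using \<open>0 < Z\<close> by (simp add: ln_div right_diff_distrib)
  qed (simp add: l)
  then have "(\<Sum>j\<in>UNIV. l $ j * ln (l $ j / p $ j)) = (\<Sum>j\<in>UNIV. l $ j * g j) - ln Z"
    using prob_simplex_sum[OF assms(1)] by (simp add: sum_subtractf flip: sum_distrib_right)
  then show ?thesis by (simp add: KL_eq_real l)
qed

section \<open>Linking Q and J\<close>

definition J_exponent ::
  "real \<Rightarrow> real \<Rightarrow> ('m \<Rightarrow> real ^ 'n::finite) \<Rightarrow> real ^ 'n \<Rightarrow> real ^ 'n \<Rightarrow> 'm \<Rightarrow> real" where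
  "J_exponent \<omega> \<nu> f Y \<psi> j = - (1 / (2 * \<omega>\<^sup>2)) * (norm (f j - Y))\<^sup>2
     + (1 - \<nu>) / (2 * \<omega>\<^sup>2) * (norm (\<psi> - f j))\<^sup>2"

lemma J_eq: "J \<omega> \<nu> p f Y \<psi> = (\<Sum>j\<in>UNIV. p $ j * exp (J_exponent \<omega> \<nu> f Y \<psi> j))"
  by (simp add: J_def J_exponent_def)

lemma J_pos:
  assumes "p \<in> prob_simplex"
  shows "0 < J \<omega> \<nu> p f Y \<psi>"
proof -
  obtain k where "0 < p $ k" using prob_simplex_pos_ex assms .
  then show ?thesis
    unfolding J_eq using prob_simplex_nonneg[OF assms] by (intro sum_pos2[of _ k]) auto
qed

text \<open>The bias-variance identity is used twice, around \<open>Y\<close> and around the free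
  point \<psi>, to eliminate the spread of the \<open>f j\<close> around the mixture. The divergence
  stays untouched, so it may be infinite.\<close>

lemma Q_eq:
  assumes "l \<in> prob_simplex" "\<omega> \<noteq> 0"
  shows "Q \<omega> \<nu> p f Y l = ereal ((1 - \<nu>) * (norm (\<psi> - mixture f l))\<^sup>2
    - 2 * \<omega>\<^sup>2 * (\<Sum>j\<in>UNIV. l $ j * J_exponent \<omega> \<nu> f Y \<psi> j)) + ereal (2 * \<omega>\<^sup>2) * KL l p"
proof -
  have "2 * \<omega>\<^sup>2 * (l $ j * J_exponent \<omega> \<nu> f Y \<psi> j) =
      (1 - \<nu>) * (l $ j * (norm (f j - \<psi>))\<^sup>2) - l $ j * (norm (f j - Y))\<^sup>2" for j
    using assms(2) by (simp add: J_exponent_def norm_minus_commute[of \<psi>] field_simps)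
  then have "2 * \<omega>\<^sup>2 * (\<Sum>j\<in>UNIV. l $ j * J_exponent \<omega> \<nu> f Y \<psi> j) =
      (1 - \<nu>) * (\<Sum>j\<in>UNIV. l $ j * (norm (f j - \<psi>))\<^sup>2) - (\<Sum>j\<in>UNIV. l $ j * (norm (f j - Y))\<^sup>2)"
    by (simp add: sum_distrib_left sum_subtractf)
  then have "(norm (mixture f l - Y))\<^sup>2 + \<nu> * (\<Sum>j\<in>UNIV. l $ j * (norm (f j - mixture f l))\<^sup>2) =
      (1 - \<nu>) * (norm (\<psi> - mixture f l))\<^sup>2
      - 2 * \<omega>\<^sup>2 * (\<Sum>j\<in>UNIV. l $ j * J_exponent \<omega> \<nu> f Y \<psi> j)"
    unfolding bias_variance_mixture[OF assms(1), of f \<psi>]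
      bias_variance_mixture[OF assms(1), of f Y] norm_minus_commute[of \<psi>]
    by (simp add: algebra_simps)
  then show ?thesis by (simp add: Q_def)
qed

text \<open>Gibbs' principle with the exponents of J as \<open>g\<close>; the linear term
  \<open>?S\<close> then cancels against the one in \<open>Q_eq\<close>.\<close>

lemma Q_lower_bound:
  assumes "l \<in> prob_simplex" "p \<in> prob_simplex" "\<omega> \<noteq> 0"
  shows "ereal ((1 - \<nu>) * (norm (\<psi> - mixture f l))\<^sup>2 - 2 * \<omega>\<^sup>2 * ln (J \<omega> \<nu> p f Y \<psi>))
    \<le> Q \<omega> \<nu> p f Y l"
proof -
  let ?S = "\<Sum>j\<in>UNIV. l $ j * J_exponent \<omega> \<nu> f Y \<psi> j"
  have "ereal (2 * \<omega>\<^sup>2) * ereal (?S - ln (J \<omega> \<nu> p f Y \<psi>)) \<le> ereal (2 * \<omega>\<^sup>2) * KL l p"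
    using gibbs_variational[OF assms(1,2), of "J_exponent \<omega> \<nu> f Y \<psi>"]
    unfolding J_eq by (intro ereal_mult_left_mono) auto
  then have "ereal ((1 - \<nu>) * (norm (\<psi> - mixture f l))\<^sup>2 - 2 * \<omega>\<^sup>2 * ?S)
      + ereal (2 * \<omega>\<^sup>2) * ereal (?S - ln (J \<omega> \<nu> p f Y \<psi>)) \<le> Q \<omega> \<nu> p f Y l"
    unfolding Q_eq[OF assms(1,3), of \<nu> p f Y \<psi>] by (intro add_left_mono)
  then show ?thesis by (simp add: algebra_simps)
qed

section \<open>Minimizers of J\<close>

lemma has_derivative_J:
  "(J \<omega> \<nu> p f Y has_derivative (\<lambda>h. (1 - \<nu>) / \<omega>\<^sup>2 *
     ((\<Sum>j\<in>UNIV. (p $ j * exp (J_exponent \<omega> \<nu> f Y \<psi> j)) *\<^sub>R (\<psi> - f j)) \<bullet> h))) (at \<psi>)"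
proof -
  have "((\<lambda>\<psi>. \<Sum>j\<in>UNIV. p $ j * exp (d j + c * (norm (\<psi> - f j))\<^sup>2)) has_derivative
      (\<lambda>h. \<Sum>j\<in>UNIV. p $ j * (exp (d j + c * (norm (\<psi> - f j))\<^sup>2) * (c * (2 * ((\<psi> - f j) \<bullet> h))))))
      (at \<psi>)" for c :: real and d
    unfolding power2_norm_eq_inner
    by (auto intro!: derivative_eq_intros ext sum.cong simp: inner_commute)
  from this[of "\<lambda>j. - (1 / (2 * \<omega>\<^sup>2)) * (norm (f j - Y))\<^sup>2" "(1 - \<nu>) / (2 * \<omega>\<^sup>2)"]
  have "(J \<omega> \<nu> p f Y has_derivative (\<lambda>h. \<Sum>j\<in>UNIV. p $ j * (exp (J_exponent \<omega> \<nu> f Y \<psi> j) *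
      ((1 - \<nu>) / (2 * \<omega>\<^sup>2) * (2 * ((\<psi> - f j) \<bullet> h)))))) (at \<psi>)"
    unfolding J_def[abs_def] J_exponent_def .
  moreover have "p $ j * (exp (J_exponent \<omega> \<nu> f Y \<psi> j) *
      ((1 - \<nu>) / (2 * \<omega>\<^sup>2) * (2 * ((\<psi> - f j) \<bullet> h)))) =
      (1 - \<nu>) / \<omega>\<^sup>2 * (((p $ j * exp (J_exponent \<omega> \<nu> f Y \<psi> j)) *\<^sub>R (\<psi> - f j)) \<bullet> h)" for j h
    by simp
  ultimately show ?thesis
    by (simp only: inner_sum_left sum_distrib_left)
qed

text \<open>J is coercive: one summand with positive weight already grows at least quadratically in
  the distance to \<open>f k\<close>. It is therefore enough to minimize over a compact
  ball.\<close>

lemma J_minimizer_exists: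
  fixes f :: "'m::finite \<Rightarrow> real ^ 'n::finite"
  assumes "p \<in> prob_simplex" "\<nu> < 1" "\<omega> \<noteq> 0"
  shows "\<exists>\<psi>. \<forall>\<phi>. J \<omega> \<nu> p f Y \<psi> \<le> J \<omega> \<nu> p f Y \<phi>"
proof -
  let ?J = "J \<omega> \<nu> p f Y"
  obtain k where k: "0 < p $ k" using prob_simplex_pos_ex assms(1) .
  define a where "a = p $ k * exp (- (1 / (2 * \<omega>\<^sup>2)) * (norm (f k - Y))\<^sup>2)"
  define c where "c = (1 - \<nu>) / (2 * \<omega>\<^sup>2)"
  have "0 < a" "0 < c" using k assms(2,3) by (auto simp: a_def c_def)
  have grow: "a * (c * (norm (\<phi> - f k))\<^sup>2) \<le> ?J \<phi>" for \<phi>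
  proof -
    have "a * (c * (norm (\<phi> - f k))\<^sup>2) \<le> a * exp (c * (norm (\<phi> - f k))\<^sup>2)"
      using \<open>0 < a\<close> exp_ge_add_one_self[of "c * (norm (\<phi> - f k))\<^sup>2"]
      by (intro mult_left_mono) linarith+
    also have "\<dots> = p $ k * exp (J_exponent \<omega> \<nu> f Y \<phi> k)"
      by (simp only: a_def c_def J_exponent_def exp_add mult.assoc)
    also have "\<dots> \<le> ?J \<phi>"
      unfolding J_eq using prob_simplex_nonneg[OF assms(1)] by (intro member_le_sum) auto
    finally show ?thesis .
  qed
  \<comment> \<open>With this radius, \<open>grow\<close> makes J at least \<open>?J (f k)\<close>
    outside the ball, and the centre \<open>f k\<close> is itself in the ball.\<close>
  define R where "R = sqrt (?J (f k) / (a * c))"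
  have "0 \<le> R"
    using J_pos[OF assms(1), of \<omega> \<nu> f Y "f k"] \<open>0 < a\<close> \<open>0 < c\<close> by (simp add: R_def)
  have "continuous_on (cball (f k) R) ?J"
    by (intro continuous_at_imp_continuous_on ballI has_derivative_continuous[OF has_derivative_J])
  then obtain \<psi> where \<psi>: "\<forall>\<phi>\<in>cball (f k) R. ?J \<psi> \<le> ?J \<phi>"
    using continuous_attains_inf[of "cball (f k) R" ?J] \<open>0 \<le> R\<close> by auto
  have "?J \<psi> \<le> ?J \<phi>" for \<phi>
  proof (cases "\<phi> \<in> cball (f k) R")
    case False
    then have "R \<le> norm (\<phi> - f k)" by (simp add: dist_norm norm_minus_commute)
    then have "?J (f k) / (a * c) \<le> (norm (\<phi> - f k))\<^sup>2"
      unfolding R_def by (rule sqrt_le_D)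
    then have "?J (f k) \<le> a * (c * (norm (\<phi> - f k))\<^sup>2)"
      using \<open>0 < a\<close> \<open>0 < c\<close> by (simp add: field_simps)
    moreover have "?J \<psi> \<le> ?J (f k)" using \<open>0 \<le> R\<close> by (intro \<psi>[rule_format]) simp
    ultimately show ?thesis using grow[of \<phi>] by linarith
  qed (rule \<psi>[rule_format])
  then show ?thesis by blast
qed

lemma J_minimizer_gibbs_mixture:
  fixes f :: "'m::finite \<Rightarrow> real ^ 'n::finite"
  assumes "p \<in> prob_simplex" "\<nu> < 1" "\<omega> \<noteq> 0"
    and min: "\<And>\<phi>. J \<omega> \<nu> p f Y \<psi> \<le> J \<omega> \<nu> p f Y \<phi>"
  obtains l where "l \<in> prob_simplex" "mixture f l = \<psi>"
    "Q \<omega> \<nu> p f Y l = ereal (- 2 * \<omega>\<^sup>2 * ln (J \<omega> \<nu> p f Y \<psi>))"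
proof -
  let ?g = "J_exponent \<omega> \<nu> f Y \<psi>" and ?Z = "J \<omega> \<nu> p f Y \<psi>"
  let ?v = "\<Sum>j\<in>UNIV. (p $ j * exp (?g j)) *\<^sub>R (\<psi> - f j)"
  have Z: "0 < ?Z" using J_pos assms(1) .
  define l where "l = (\<chi> j. p $ j * exp (?g j) / ?Z)"
  have "(\<Sum>j\<in>UNIV. l $ j) = 1"
    using Z by (simp add: l_def J_eq flip: sum_divide_distrib)
  then have l: "l \<in> prob_simplex"
    using prob_simplex_nonneg[OF assms(1)] Z by (simp add: prob_simplex_def l_def)
  have "(\<lambda>h. (1 - \<nu>) / \<omega>\<^sup>2 * (?v \<bullet> h)) = (\<lambda>h. 0)"
    using min by (intro has_derivative_local_min[OF has_derivative_J]) simp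
  \<comment> \<open>Evaluating the zero derivative at \<open>h = ?v\<close> leaves a nonzero
    multiple of the squared norm of \<open>?v\<close>.\<close>
  then have "(1 - \<nu>) / \<omega>\<^sup>2 * (?v \<bullet> ?v) = 0" by metis
  then have "?v = 0" using assms(2,3) by simp
  moreover have "?v = ?Z *\<^sub>R (\<Sum>j\<in>UNIV. l $ j *\<^sub>R (\<psi> - f j))"
    using Z by (simp add: l_def scaleR_sum_right)
  ultimately have "(\<Sum>j\<in>UNIV. l $ j *\<^sub>R (\<psi> - f j)) = 0" using Z by simp
  then have mix: "mixture f l = \<psi>"
    using prob_simplex_sum[OF l]
    by (simp add: scaleR_diff_right sum_subtractf mixture_def flip: scaleR_sum_left)
  have "KL l p = ereal ((\<Sum>j\<in>UNIV. l $ j * ?g j) - ln ?Z)"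
    using l Z by (rule KL_gibbs_weights) (simp add: l_def)
  then have "Q \<omega> \<nu> p f Y l = ereal (- 2 * \<omega>\<^sup>2 * ln ?Z)"
    using Q_eq[OF l assms(3), of \<nu> p f Y \<psi>] mix by (simp add: algebra_simps)
  with l mix show thesis by (rule that)
qed

theorem theorem1:
  fixes Y :: "real ^ 'n::finite"
    and f :: "'m::finite \<Rightarrow> real ^ 'n"
    and \<pi> :: "real ^ 'm"
    and \<nu> \<omega> :: real
  assumes "\<pi> \<in> prob_simplex"
    and "0 < \<nu>" and "\<nu> < 1" and "0 < \<omega>"
  shows "(\<exists>!\<psi>. is_arg_min (J \<omega> \<nu> \<pi> f Y) (\<lambda>_. True) \<psi>) \<and>
    (\<forall>lQ. is_arg_min (Q \<omega> \<nu> \<pi> f Y) (\<lambda>l. l \<in> prob_simplex) lQ \<longrightarrow>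
       psi_X \<omega> \<nu> \<pi> f Y = mixture f lQ)"
proof -
  let ?J = "J \<omega> \<nu> \<pi> f Y" and ?Q = "Q \<omega> \<nu> \<pi> f Y"
  have "\<omega> \<noteq> 0" using assms(4) by simp
  have J_min: "is_arg_min ?J (\<lambda>_. True) \<psi> \<longleftrightarrow> (\<forall>\<phi>. ?J \<psi> \<le> ?J \<phi>)" for \<psi>
    by (auto simp: is_arg_min_def not_less)
  \<comment> \<open>Used twice below: for uniqueness of the minimizer of J and for an arbitrary
    minimizer of Q.\<close>
  have eq_mixture: "\<psi> = mixture f l"
    if "l \<in> prob_simplex" "?Q l \<le> ereal (- 2 * \<omega>\<^sup>2 * ln (?J \<psi>))" for \<psi> l
  proof -
    have "ereal ((1 - \<nu>) * (norm (\<psi> - mixture f l))\<^sup>2 - 2 * \<omega>\<^sup>2 * ln (?J \<psi>))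
        \<le> ereal (- 2 * \<omega>\<^sup>2 * ln (?J \<psi>))"
      using Q_lower_bound[OF that(1) assms(1) \<open>\<omega> \<noteq> 0\<close>] that(2) by (rule order_trans)
    then have "(norm (\<psi> - mixture f l))\<^sup>2 \<le> 0"
      using assms(3) by (simp add: mult_le_0_iff)
    then show ?thesis by simp
  qed
  obtain \<psi> where \<psi>: "\<And>\<phi>. ?J \<psi> \<le> ?J \<phi>"
    using J_minimizer_exists[OF assms(1,3) \<open>\<omega> \<noteq> 0\<close>] by blast
  obtain l where l: "l \<in> prob_simplex" "mixture f l = \<psi>" "?Q l = ereal (- 2 * \<omega>\<^sup>2 * ln (?J \<psi>))"
    using J_minimizer_gibbs_mixture[OF assms(1,3) \<open>\<omega> \<noteq> 0\<close> \<psi>] .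
  have unique: "\<phi> = \<psi>" if "\<forall>\<xi>. ?J \<phi> \<le> ?J \<xi>" for \<phi>
  proof -
    \<comment> \<open>Equal values of J let the weights \<open>l\<close> obtained from \<psi> meet
      the bound for \<phi> as well, so both points are \<open>mixture f l\<close>.\<close>
    have "?J \<phi> = ?J \<psi>" using that \<psi> by (blast intro: order_antisym)
    then show ?thesis using eq_mixture[of l \<phi>] l by simp
  qed
  have ex1: "\<exists>!\<psi>. is_arg_min ?J (\<lambda>_. True) \<psi>"
    unfolding J_min using \<psi> unique by blast
  \<comment> \<open>\<open>psi_X\<close> is a Hilbert choice, so it is a minimizer only because one
    exists.\<close>
  have "is_arg_min ?J (\<lambda>_. True) (psi_X \<omega> \<nu> \<pi> f Y)"
    unfolding psi_X_def arg_min_def using ex1 by (rule someI_ex[OF ex1_implies_ex])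
  then have "psi_X \<omega> \<nu> \<pi> f Y = \<psi>"
    unfolding J_min by (rule unique)
  moreover have "\<psi> = mixture f lQ"
    if "is_arg_min ?Q (\<lambda>l. l \<in> prob_simplex) lQ" for lQ
  proof (rule eq_mixture)
    show "lQ \<in> prob_simplex" using that by (simp add: is_arg_min_def)
    \<comment> \<open>The Gibbs weights \<open>l\<close> compete with \<open>lQ\<close> and attain
      exactly this value.\<close>
    show "?Q lQ \<le> ereal (- 2 * \<omega>\<^sup>2 * ln (?J \<psi>))"
      using that l(1) unfolding l(3)[symmetric] is_arg_min_def by (meson not_less)
  qed
  ultimately show ?thesis using ex1 by blast
qed

end
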